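(* Let $X$ be a non-compact Hausdorff space. The following are equivalent: (i) $\mathbb K(X)$ is Hurewicz. (ii) $\mathbb K(X)\models\mathsf S_{\mathrm{fin}}(\mathcal K,\mathcal K^{\mathrm{gp}})$. (iii) $X\models\mathsf S_{\mathrm{fin}}(\mathcal K,\mathcal K)$ and $\mathcal K_X^{\mathrm{gp}}=\mathcal K_X\cap[\mathscr T_X]^\omega$. (iv) $X\models\mathsf S_{\mathrm{fin}}(\mathcal K,\mathcal K^{\mathrm{gp}})$. (v) One does not have a winning strategy in $\mathsf G_{\mathrm{fin}}(\mathcal K_X,\mathcal K_X^{\mathrm{gp}})$.
   Context: For a set $Y$, $[Y]^{<\omega}$ is the set of non-empty finite subsets of $Y$ and $[Y]^\omega$ is the set of countably infinite subsets of $Y$. For a space $Z$, $K(Z)$ is the set of non-empty compact subsets of $Z$; $\mathscr T_Z$ is the set of open $U\subseteq Z$ with $U\neq\emptyset$ and $U\neq Z$; $\mathcal O_Z$ is the set of all $\mathscr U\subseteq\mathscr T_Z$ with $\bigcup\mathscr U=Z$; $\mathcal K_Z$ (the $k$-covers) is the set of all $\mathscr U\in\mathcal O_Z$ such that every $K\in K(Z)$ is contained in some $U\in\mathscr U$. $\mathbb K(X)$ is $K(X)$ with the Vietoris topology, generated by the sets $\{K:K\subseteq U\}$ and $\{K:K\cap U\neq\emptyset\}$ for $U\subseteq X$ open. $Z$ is Hurewicz if for every sequence $\langle\mathscr U_n:n\in\omega\rangle$ in $\mathcal O_Z$ there are $\mathscr F_n\in[\mathscr U_n]^{<\omega}$ such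 that for every $z\in Z$ there is $m$ with $z\in\bigcup\mathscr F_n$ for all $n\geq m$. For a class $\mathfrak C$, $\mathscr C\in\mathfrak C$ is groupable if there is $\phi:\mathscr C\to\omega$ with every $\phi^{-1}(n)$ finite and with $\bigcup\{\phi^{-1}(n):n\in J\}\in\mathfrak C$ for every infinite $J\subseteq\omega$; $\mathfrak C^{\mathrm{gp}}$ is the set of groupable members of $\mathfrak C$. $\mathsf S_{\mathrm{fin}}(\mathcal A,\mathcal B)$: for every sequence $\langle\mathscr U_n:n\in\omega\rangle$ in $\mathcal A$ there are $\mathscr F_n\in[\mathscr U_n]^{<\omega}$ with $\bigcup_n\mathscr F_n\in\mathcal B$. $Z\models\mathsf S_{\mathrm{fin}}(\mathcal K,\mathcal K^{\mathrm{gp}})$ means $\mathsf S_{\mathrm{fin}}(\mathcal K_Z,\mathcal K_Z^{\mathrm{gp}})$ holds; similarly for $\mathsf S_{\mathrm{fin}}(\mathcal K,\mathcal K)$. In the game $\mathsf G_{\mathrm{fin}}(\mathcal A,\mathcal B)$, in inning $n\in\omega$ One plays $A_n\in\mathcal A$ and Two responds with $\mathscr F_n\in[A_n]^{<\omega}$; Two wins if $\bigcup_n\mathscr F_n\in\mathcal B$, otherwise One wins. A strategy for One is a function $\sigma$ from finite sequences of Two's moves to $\mathcal A$; it is winning if for every sequence with $\mathscr F_n\in[\sigma(\langle\mathscr F_k:k<n\rangle)]^{<\omega}$ for all $n$, $\bigcup_n\mathscr F_n\notin\mathcal B$. *)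

theory Defs
  imports "HOL-Analysis.Analysis"
begin

definition finite_parts :: "'b set \<Rightarrow> 'b set set" where
  "finite_parts Y = {F. F \<subseteq> Y \<and> finite F \<and> F \<noteq> {}}"

definition countably_infinite_parts :: "'b set \<Rightarrow> 'b set set" where
  "countably_infinite_parts Y = {A. A \<subseteq> Y \<and> countable A \<and> infinite A}"

definition compact_sets :: "'a topology \<Rightarrow> 'a set set" where
  "compact_sets Z = {K. compactin Z K \<and> K \<noteq> {}}"

definition proper_opens :: "'a topology \<Rightarrow> 'a set set" where
  "proper_opens Z = {U. openin Z U \<and> U \<noteq> {} \<and> U \<noteq> topspace Z}"

definition open_covers :: "'a topology \<Rightarrow> 'a set set set" where
  "open_covers Z = {\<U>. \<U> \<subseteq> proper_opens Z \<and> \<Union>\<U> = topspace Z}"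

definition k_covers :: "'a topology \<Rightarrow> 'a set set set" where
  "k_covers Z = {\<U> \<in> open_covers Z. \<forall>K \<in> compact_sets Z. \<exists>U \<in> \<U>. K \<subseteq> U}"

definition vietoris :: "'a topology \<Rightarrow> 'a set topology" where
  "vietoris X = topology_generated_by
     ({{K \<in> compact_sets X. K \<subseteq> U} |U. openin X U} \<union>
      {{K \<in> compact_sets X. K \<inter> U \<noteq> {}} |U. openin X U})"

lemma topspace_vietoris: "topspace (vietoris X) = compact_sets X"
proof
  show "topspace (vietoris X) \<subseteq> compact_sets X"
    unfolding vietoris_def topology_generated_by_topspace by (auto 0 0)
  show "compact_sets X \<subseteq> topspace (vietoris X)"
  proof
    fix K assume K: "K \<in> compact_sets X"
    then have "K \<subseteq> topspace X"
      by (simp add: compact_sets_def compactin_subset_topspace)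
    with K have "K \<in> {K \<in> compact_sets X. K \<subseteq> topspace X}" by simp
    moreover have "{K \<in> compact_sets X. K \<subseteq> topspace X} \<in>
        {{K \<in> compact_sets X. K \<subseteq> U} |U. openin X U}"
      using openin_topspace[of X] by (intro CollectI exI conjI) (rule refl)
    ultimately show "K \<in> topspace (vietoris X)"
      unfolding vietoris_def topology_generated_by_topspace by (meson UnI1 UnionI)
  qed
qed

definition hurewicz :: "'a topology \<Rightarrow> bool" where
  "hurewicz Z \<longleftrightarrow>
     (\<forall>\<U> :: nat \<Rightarrow> 'a set set. (\<forall>n. \<U> n \<in> open_covers Z) \<longrightarrow>
       (\<exists>\<F>. (\<forall>n. \<F> n \<in> finite_parts (\<U> n)) \<and>
            (\<forall>z \<in> topspace Z. \<exists>m. \<forall>n \<ge> m. z \<in> \<Union>(\<F> n))))"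

definition groupable_members :: "'b set set \<Rightarrow> 'b set set" where
  "groupable_members \<CC> = {\<C> \<in> \<CC>. \<exists>\<phi> :: 'b \<Rightarrow> nat.
     (\<forall>n. finite (\<phi> -` {n} \<inter> \<C>)) \<and>
     (\<forall>J. infinite J \<longrightarrow> (\<Union>n\<in>J. \<phi> -` {n} \<inter> \<C>) \<in> \<CC>)}"

definition S_fin :: "'b set set \<Rightarrow> 'b set set \<Rightarrow> bool" where
  "S_fin \<A> \<B> \<longleftrightarrow>
     (\<forall>\<U> :: nat \<Rightarrow> 'b set. (\<forall>n. \<U> n \<in> \<A>) \<longrightarrow>
       (\<exists>\<F>. (\<forall>n. \<F> n \<in> finite_parts (\<U> n)) \<and> (\<Union>n. \<F> n) \<in> \<B>))"

(* Strategies are total functions in HOL; only their values on finite sequences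
   of possible moves of Two (finite non-empty subsets of members of \<A>) matter. *)
definition strategy_One :: "'b set set \<Rightarrow> ('b set list \<Rightarrow> 'b set) \<Rightarrow> bool" where
  "strategy_One \<A> \<sigma> \<longleftrightarrow> (\<forall>s \<in> lists (\<Union>A\<in>\<A>. finite_parts A). \<sigma> s \<in> \<A>)"

definition winning_strategy_One ::
    "'b set set \<Rightarrow> 'b set set \<Rightarrow> ('b set list \<Rightarrow> 'b set) \<Rightarrow> bool" where
  "winning_strategy_One \<A> \<B> \<sigma> \<longleftrightarrow> strategy_One \<A> \<sigma> \<and>
     (\<forall>\<F> :: nat \<Rightarrow> 'b set.
       (\<forall>n. \<F> n \<in> finite_parts (\<sigma> (map \<F> [0..<n]))) \<longrightarrow> (\<Union>n. \<F> n) \<notin> \<B>)"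

definition One_wins_G_fin :: "'b set set \<Rightarrow> 'b set set \<Rightarrow> bool" where
  "One_wins_G_fin \<A> \<B> \<longleftrightarrow> (\<exists>\<sigma>. winning_strategy_One \<A> \<B> \<sigma>)"

end

theory Submission
  imports Defs
begin

text \<open>
  All five conditions are equivalent to one property of \<open>X\<close>, called \<open>k_hurewicz\<close> below: from
  every sequence of k-covers one can select finite subfamilies such that each compact set lies
  in a member of all but finitely many of them.

  For an arbitrary non-empty space \<open>Z\<close>, the selection principle with groupable outcome, the game
  and the condition on countable k-covers all say the same as \<open>k_hurewicz Z\<close>.  A k-cover remains a
  k-cover when finitely many members are removed (\<open>k_cover_Diff_finite\<close>), because a compact set can
  be enlarged by one point outside each removed member.  Hence selections can be kept pairwise
  disjoint, and a disjoint selection is its own grouping (\<open>groupable_k_cover_iff\<close>).  One has no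
  winning strategy (\<open>not_One_wins_if_k_hurewicz\<close>): k-covers can be thinned to countable ones, so the
  positions that matter form a countable tree, and a single application of \<open>k_hurewicz\<close> chooses an
  answer at every position of that tree at once, with each compact set missed by only finitely
  many answers.  The branch that follows these answers defeats the strategy.  Conversely, groups
  of a selection from successive common refinements give back an eventual selection
  (\<open>k_hurewicz_if_S_fin_groupable\<close>).

  The hyperspace enters through the sets \<open>compacts_within X K\<close> of the compact subsets of a compact
  \<open>K\<close>.  They are compact in the Vietoris topology, and an open set that contains all compact
  subsets of \<open>K\<close> contains all compact subsets of some open \<open>U \<supseteq> K\<close> (\<open>vietoris_tube\<close>).  So k-covers
  of \<open>\<K>(X)\<close>, and finite unions from open covers of \<open>\<K>(X)\<close>, leave a trace that is a k-cover of \<open>X\<close>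
  (\<open>k_hurewicz_select_traces\<close>).  In the other direction, \<open>U \<mapsto> compacts_within X U\<close> turns k-covers of
  \<open>X\<close> into open covers of the hyperspace, and even into k-covers because the union of a compact
  family of compact sets is compact (\<open>compact_Union_vietoris\<close>).
\<close>

section \<open>The eventual selection property for k-covers\<close>

definition eventually_covers :: "(nat \<Rightarrow> 'a set set) \<Rightarrow> 'a set \<Rightarrow> bool" where
  "eventually_covers F K \<longleftrightarrow> (\<forall>\<^sub>F n in sequentially. \<exists>U\<in>F n. K \<subseteq> U)"

lemma eventually_covers_iff: "eventually_covers F K \<longleftrightarrow> (\<exists>m. \<forall>n\<ge>m. \<exists>U\<in>F n. K \<subseteq> U)"
  by (simp add: eventually_covers_def eventually_sequentially)

lemma eventually_covers_cofinite: "eventually_covers F K \<longleftrightarrow> finite {n. \<not> (\<exists>U\<in>F n. K \<subseteq> U)}"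
  by (simp add: eventually_covers_def cofinite_eq_sequentially[symmetric] eventually_cofinite)

text \<open>
  The Hurewicz property with compact sets in place of points and k-covers in place of open
  covers; it mediates between all conditions of the theorem.
\<close>

definition k_hurewicz :: "'a topology \<Rightarrow> bool" where
  "k_hurewicz Z \<longleftrightarrow>
     (\<forall>\<U>. (\<forall>n. \<U> n \<in> k_covers Z) \<longrightarrow>
       (\<exists>F. (\<forall>n. F n \<in> finite_parts (\<U> n)) \<and> (\<forall>K\<in>compact_sets Z. eventually_covers F K)))"

lemma k_hurewiczE:
  assumes "k_hurewicz Z" and "\<And>n. \<U> n \<in> k_covers Z"
  obtains F where "\<And>n. F n \<in> finite_parts (\<U> n)"
    and "\<And>K. K \<in> compact_sets Z \<Longrightarrow> eventually_covers F K"
  using assms unfolding k_hurewicz_def by blast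

lemma k_coversI:
  assumes "\<U> \<subseteq> proper_opens Z" and "\<And>K. K \<in> compact_sets Z \<Longrightarrow> \<exists>U\<in>\<U>. K \<subseteq> U"
  shows "\<U> \<in> k_covers Z"
proof -
  have "x \<in> \<Union>\<U>" if "x \<in> topspace Z" for x
    using assms(2)[of "{x}"] that by (auto simp: compact_sets_def)
  moreover have "\<Union>\<U> \<subseteq> topspace Z"
    using assms(1) by (auto simp: proper_opens_def dest: openin_subset)
  ultimately show ?thesis
    using assms by (auto simp: k_covers_def open_covers_def)
qed

lemma k_covers_subset_proper_opens: "\<U> \<in> k_covers Z \<Longrightarrow> \<U> \<subseteq> proper_opens Z"
  by (simp add: k_covers_def open_covers_def)

lemma k_coversD: "\<U> \<in> k_covers Z \<Longrightarrow> K \<in> compact_sets Z \<Longrightarrow> \<exists>U\<in>\<U>. K \<subseteq> U"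
  by (simp add: k_covers_def)

text \<open>
  Every member of a k-cover omits some point.  Adding to \<open>K\<close> one omitted point for each member
  of \<open>E\<close> leaves it compact, and a member containing the enlarged set cannot belong to \<open>E\<close>.
\<close>

lemma k_cover_Diff_finite:
  assumes \<U>: "\<U> \<in> k_covers Z" and "finite E"
  shows "\<U> - E \<in> k_covers Z"
proof (rule k_coversI)
  show "\<U> - E \<subseteq> proper_opens Z"
    using k_covers_subset_proper_opens[OF \<U>] by blast
  fix K assume K: "K \<in> compact_sets Z"
  have "\<forall>U\<in>\<U>. \<exists>x. x \<in> topspace Z - U"
    using k_covers_subset_proper_opens[OF \<U>] by (auto simp: proper_opens_def dest: openin_subset)
  then obtain p where p: "\<And>U. U \<in> \<U> \<Longrightarrow> p U \<in> topspace Z - U"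
    by metis
  have "compactin Z (K \<union> p ` (E \<inter> \<U>))"
  proof (rule compactin_Un)
    show "compactin Z K"
      using K by (simp add: compact_sets_def)
    show "compactin Z (p ` (E \<inter> \<U>))"
      using p \<open>finite E\<close> by (intro finite_imp_compactin) auto
  qed
  then have "K \<union> p ` (E \<inter> \<U>) \<in> compact_sets Z"
    using K by (auto simp: compact_sets_def)
  then obtain U where "U \<in> \<U>" "K \<union> p ` (E \<inter> \<U>) \<subseteq> U"
    using k_coversD[OF \<U>] by blast
  then show "\<exists>U\<in>\<U> - E. K \<subseteq> U"
    using p by blast
qed

lemma k_cover_nonempty: "topspace Z \<noteq> {} \<Longrightarrow> \<U> \<in> k_covers Z \<Longrightarrow> \<U> \<noteq> {}"
  unfolding k_covers_def open_covers_def by blast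

lemma k_cover_infinite:
  assumes "topspace Z \<noteq> {}" and "\<U> \<in> k_covers Z"
  shows "infinite \<U>"
  using k_cover_Diff_finite[OF assms(2), of \<U>] k_cover_nonempty[OF assms(1)] by auto

text \<open>
  The quantification over all infinite index sets in groupability amounts to eventual covering:
  if a compact set were missed by infinitely many groups, their union would not be a k-cover.
\<close>

lemma groupable_k_cover_iff:
  assumes "\<C> \<subseteq> proper_opens Z"
  shows "\<C> \<in> groupable_members (k_covers Z) \<longleftrightarrow>
    (\<exists>G. (\<forall>n. finite (G n)) \<and> disjoint_family G \<and> (\<Union>n. G n) = \<C> \<and>
         (\<forall>K\<in>compact_sets Z. eventually_covers G K))" (is "?L \<longleftrightarrow> ?R")
proof
  assume ?L
  then obtain \<phi> :: "'a set \<Rightarrow> nat" where fin: "\<And>n. finite (\<phi> -` {n} \<inter> \<C>)"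
    and J: "\<And>J. infinite J \<Longrightarrow> (\<Union>n\<in>J. \<phi> -` {n} \<inter> \<C>) \<in> k_covers Z"
    by (auto simp: groupable_members_def)
  let ?G = "\<lambda>n. \<phi> -` {n} \<inter> \<C>"
  have "eventually_covers ?G K" if K: "K \<in> compact_sets Z" for K
  proof (rule ccontr)
    assume "\<not> eventually_covers ?G K"
    then have "infinite {n. \<not> (\<exists>U\<in>?G n. K \<subseteq> U)}"
      unfolding eventually_covers_cofinite .
    from k_coversD[OF J[OF this] K] show False
      by blast
  qed
  moreover have "disjoint_family ?G" "(\<Union>n. ?G n) = \<C>"
    by (auto simp: disjoint_family_on_def)
  ultimately show ?R
    using fin by (intro exI[of _ ?G]) auto
next
  assume ?R
  then obtain G where fin: "\<And>n. finite (G n)" and disj: "disjoint_family G"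
    and un: "(\<Union>n. G n) = \<C>" and ev: "\<And>K. K \<in> compact_sets Z \<Longrightarrow> eventually_covers G K"
    by blast
  \<comment> \<open>Outside the union of the groups the value of \<open>\<phi>\<close> is arbitrary.\<close>
  define \<phi> where "\<phi> U = (SOME n. U \<in> G n)" for U
  have \<phi>: "\<phi> U = n" if "U \<in> G n" for U n
  proof -
    have "U \<in> G (\<phi> U)"
      unfolding \<phi>_def using that by (rule someI)
    with that disj show ?thesis
      by (auto simp: disjoint_family_on_def)
  qed
  have fibre: "\<phi> -` {n} \<inter> \<C> = G n" for n
    using \<phi> un by auto
  have "(\<Union>n\<in>J. G n) \<in> k_covers Z" if "infinite J" for J
  proof (rule k_coversI)
    show "(\<Union>n\<in>J. G n) \<subseteq> proper_opens Z"
      using assms un by blast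
    fix K assume "K \<in> compact_sets Z"
    then obtain m where "\<forall>n\<ge>m. \<exists>U\<in>G n. K \<subseteq> U"
      using ev unfolding eventually_covers_iff by blast
    moreover obtain n where "n \<in> J" "n \<ge> m"
      using \<open>infinite J\<close> infinite_nat_iff_unbounded_le by blast
    ultimately show "\<exists>U\<in>(\<Union>n\<in>J. G n). K \<subseteq> U"
      by blast
  qed
  moreover from this[of UNIV] have "\<C> \<in> k_covers Z"
    using un by simp
  ultimately show ?L
    unfolding groupable_members_def using fin
    by (intro CollectI conjI exI[of _ \<phi>]) (simp_all add: fibre del: UN_simps)
qed

section \<open>Selection principles and the game\<close>

text \<open>
  A sequence witnessing the failure of the selection principle is a winning strategy that
  ignores the moves of Two.
\<close>

lemma S_fin_if_not_One_wins:
  assumes "\<not> One_wins_G_fin \<A> \<B>"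
  shows "S_fin \<A> \<B>"
proof (rule ccontr)
  assume "\<not> S_fin \<A> \<B>"
  then obtain \<U> :: "nat \<Rightarrow> 'a set" where "\<forall>n. \<U> n \<in> \<A>"
    and "\<forall>F. (\<forall>n. F n \<in> finite_parts (\<U> n)) \<longrightarrow> (\<Union>n. F n) \<notin> \<B>"
    unfolding S_fin_def by blast
  then have "winning_strategy_One \<A> \<B> (\<lambda>s. \<U> (length s))"
    by (simp add: winning_strategy_One_def strategy_One_def)
  with assms show False
    by (auto simp: One_wins_G_fin_def)
qed

text \<open>
  The selection principle is applied to the common refinements of the first \<open>n + 1\<close> covers, so
  that whatever is selected at stage \<open>n\<close> or later can be enlarged to a member of the \<open>n\<close>-th
  cover.  The groups of the outcome need not respect the stages, but all sufficiently late groups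
  consist of late selections only.
\<close>

lemma k_hurewicz_if_S_fin_groupable:
  assumes S: "S_fin (k_covers Z) (groupable_members (k_covers Z))" and ne: "topspace Z \<noteq> {}"
  shows "k_hurewicz Z"
  unfolding k_hurewicz_def
proof (intro allI impI)
  fix \<U> :: "nat \<Rightarrow> 'a set set"
  assume \<U>: "\<forall>n. \<U> n \<in> k_covers Z"
  define \<V> where "\<V> n = {V \<in> proper_opens Z. \<forall>i\<le>n. \<exists>U\<in>\<U> i. V \<subseteq> U}" for n
  have "\<V> n \<in> k_covers Z" for n
  proof (rule k_coversI)
    fix K assume K: "K \<in> compact_sets Z"
    then have "\<forall>i. \<exists>U\<in>\<U> i. K \<subseteq> U"
      using \<U> k_coversD by blast
    then obtain u where u: "\<And>i. u i \<in> \<U> i" "\<And>i. K \<subseteq> u i"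
      by metis
    have op: "u i \<in> proper_opens Z" for i
      using u(1) \<U> k_covers_subset_proper_opens by blast
    let ?V = "\<Inter>i\<le>n. u i"
    have "openin Z ?V"
      using op by (intro openin_INT2) (auto simp: proper_opens_def)
    moreover have "?V \<noteq> {}"
      using u(2) K unfolding compact_sets_def by blast
    moreover have "?V \<noteq> topspace Z"
      using op[of 0] by (auto simp: proper_opens_def dest: openin_subset)
    ultimately have "?V \<in> \<V> n"
      unfolding \<V>_def proper_opens_def using u(1) by blast
    then show "\<exists>U\<in>\<V> n. K \<subseteq> U"
      using u(2) by blast
  qed (auto simp: \<V>_def)
  then obtain F where F: "\<And>n. F n \<in> finite_parts (\<V> n)"
    and gp: "(\<Union>n. F n) \<in> groupable_members (k_covers Z)"
    using S unfolding S_fin_def by meson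
  have "(\<Union>n. F n) \<subseteq> proper_opens Z"
    using F by (auto simp: finite_parts_def \<V>_def)
  then obtain G where fin: "\<And>n. finite (G n)" and disj: "disjoint_family G"
    and un: "(\<Union>n. G n) = (\<Union>n. F n)"
    and ev: "\<And>K. K \<in> compact_sets Z \<Longrightarrow> eventually_covers G K"
    using gp groupable_k_cover_iff by metis
  have "\<exists>k\<ge>n. \<forall>V\<in>G k. \<exists>U\<in>\<U> n. V \<subseteq> U" for n
  proof -
    \<comment> \<open>Disjointness lets the finitely many sets selected before stage \<open>n\<close> meet only
      finitely many groups.\<close>
    let ?E = "\<Union>j<n. F j"
    have finE: "finite ?E"
      using F by (auto simp: finite_parts_def)
    have "\<forall>V\<in>?E. \<exists>k. V \<in> G k"
      using un by blast
    then obtain g where g: "\<And>V. V \<in> ?E \<Longrightarrow> V \<in> G (g V)"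
      by metis
    have "finite (g ` ?E)"
      using finE by (rule finite_imageI)
    then have "\<not> {n..} \<subseteq> g ` ?E"
      using infinite_Ici[of n] finite_subset by blast
    then obtain k where k: "k \<ge> n" "k \<notin> g ` ?E"
      by auto
    have "\<exists>U\<in>\<U> n. V \<subseteq> U" if "V \<in> G k" for V
    proof -
      have "V \<notin> ?E"
      proof
        assume "V \<in> ?E"
        then have "V \<in> G (g V)" "g V \<noteq> k"
          using g k(2) by auto
        with that disj show False
          by (auto simp: disjoint_family_on_def)
      qed
      have "V \<in> (\<Union>n. F n)"
        unfolding un[symmetric] using that by (rule UN_I[OF UNIV_I])
      then obtain j where j: "V \<in> F j"
        by blast
      have "j \<ge> n"
        using \<open>V \<notin> ?E\<close> j by (meson UN_I lessThan_iff not_less)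
      moreover have "V \<in> \<V> j"
        using F[of j] j by (auto simp: finite_parts_def)
      ultimately show ?thesis
        by (auto simp: \<V>_def)
    qed
    with k(1) show ?thesis
      by blast
  qed
  then obtain \<kappa> where \<kappa>: "\<And>n. \<kappa> n \<ge> n" "\<And>n. \<forall>V\<in>G (\<kappa> n). \<exists>U\<in>\<U> n. V \<subseteq> U"
    by metis
  then obtain u where u: "\<And>n V. V \<in> G (\<kappa> n) \<Longrightarrow> u n V \<in> \<U> n \<and> V \<subseteq> u n V"
    by metis
  have "\<exists>U. U \<in> \<U> n" for n
    using k_cover_nonempty[OF ne, of "\<U> n"] \<U> by blast
  then obtain w where w: "\<And>n. w n \<in> \<U> n"
    by metis
  \<comment> \<open>The extra element \<open>w n\<close> keeps the selection non-empty when the group is empty.\<close>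
  define H where "H n = insert (w n) (u n ` G (\<kappa> n))" for n
  have "H n \<in> finite_parts (\<U> n)" for n
    using u w fin by (auto simp: H_def finite_parts_def)
  moreover have "eventually_covers H K" if K: "K \<in> compact_sets Z" for K
  proof -
    obtain m where m: "\<forall>n\<ge>m. \<exists>U\<in>G n. K \<subseteq> U"
      using ev[OF K] unfolding eventually_covers_iff by blast
    have "\<exists>U\<in>H n. K \<subseteq> U" if n: "n \<ge> m" for n
    proof -
      obtain V where "V \<in> G (\<kappa> n)" "K \<subseteq> V"
        using m \<kappa>(1)[of n] n by (meson order_trans)
      then show ?thesis
        using u[of V n] unfolding H_def by blast
    qed
    then show ?thesis
      unfolding eventually_covers_iff by blast
  qed
  ultimately show "\<exists>F. (\<forall>n. F n \<in> finite_parts (\<U> n)) \<and> (\<forall>K\<in>compact_sets Z. eventually_covers F K)"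
    by blast
qed

text \<open>
  Since sets enter through ``all but finitely many indices'' only, the order of the indices is
  irrelevant, and the selection works over any countable index set.
\<close>

lemma k_hurewicz_countable_index:
  assumes Z: "k_hurewicz Z" and "countable T" and "T \<noteq> {}"
    and \<U>: "\<And>t. t \<in> T \<Longrightarrow> \<U> t \<in> k_covers Z"
  obtains F where "\<And>t. t \<in> T \<Longrightarrow> F t \<in> finite_parts (\<U> t)"
    and "\<And>K. K \<in> compact_sets Z \<Longrightarrow> finite {t\<in>T. \<not> (\<exists>U\<in>F t. K \<subseteq> U)}"
proof -
  obtain G where G: "\<And>n. G n \<in> finite_parts (\<U> (from_nat_into T n))"
    and ev: "\<And>K. K \<in> compact_sets Z \<Longrightarrow> eventually_covers G K"
    using k_hurewiczE[OF Z, of "\<lambda>n. \<U> (from_nat_into T n)"] \<U> from_nat_into[OF \<open>T \<noteq> {}\<close>]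
    by blast
  have 1: "G (to_nat_on T t) \<in> finite_parts (\<U> t)" if "t \<in> T" for t
    using G[of "to_nat_on T t"] that \<open>countable T\<close> by simp
  have 2: "finite {t\<in>T. \<not> (\<exists>U\<in>G (to_nat_on T t). K \<subseteq> U)}" if "K \<in> compact_sets Z" for K
  proof -
    have "finite {n. \<not> (\<exists>U\<in>G n. K \<subseteq> U)}"
      using ev[OF that]
      unfolding eventually_covers_cofinite .
    moreover have "inj_on (to_nat_on T) {t\<in>T. \<not> (\<exists>U\<in>G (to_nat_on T t). K \<subseteq> U)}"
      using inj_on_to_nat_on[OF \<open>countable T\<close>] by (rule inj_on_subset) blast
    ultimately show ?thesis
      by (elim inj_on_finite[rotated 2]) auto
  qed
  show thesis
    using that[of "\<lambda>t. G (to_nat_on T t)"] 1 2 by blast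
qed

lemma k_hurewicz_countable_subcover:
  assumes "k_hurewicz Z" and \<U>: "\<U> \<in> k_covers Z"
  obtains \<V> where "\<V> \<subseteq> \<U>" "countable \<V>" "\<V> \<in> k_covers Z"
proof -
  obtain F where F: "\<And>n::nat. F n \<in> finite_parts \<U>"
    and ev: "\<And>K. K \<in> compact_sets Z \<Longrightarrow> eventually_covers F K"
    using k_hurewiczE[OF assms(1), of "\<lambda>_. \<U>"] \<U> by blast
  have sub: "(\<Union>n. F n) \<subseteq> \<U>" and "countable (\<Union>n. F n)"
    using F by (auto simp: finite_parts_def intro: countable_finite)
  moreover have "(\<Union>n. F n) \<in> k_covers Z"
  proof (rule k_coversI)
    show "(\<Union>n. F n) \<subseteq> proper_opens Z"
      using sub k_covers_subset_proper_opens[OF \<U>] by blast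
    fix K assume "K \<in> compact_sets Z"
    then show "\<exists>U\<in>(\<Union>n. F n). K \<subseteq> U"
      using ev[of K] unfolding eventually_covers_iff by blast
  qed
  ultimately show thesis
    using that by blast
qed

text \<open>
  Level by level: a sequence of length \<open>n + 1\<close> arises from one of length \<open>n\<close> by appending one of
  countably many options.
\<close>

lemma countable_tree:
  assumes "\<And>s. countable (B s)"
  shows "countable {s. \<forall>i<length s. s ! i \<in> B (take i s)}" (is "countable ?T")
proof -
  have "countable {s\<in>?T. length s = n}" for n
  proof (induction n)
    case 0
    have "{s\<in>?T. length s = 0} \<subseteq> {[]}"
      by auto
    then show ?case
      by (rule countable_subset) simp
  next
    case (Suc n)
    have "{s\<in>?T. length s = Suc n} \<subseteq> (\<Union>s\<in>{s\<in>?T. length s = n}. (\<lambda>x. s @ [x]) ` B s)"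
    proof
      fix s assume s: "s \<in> {s\<in>?T. length s = Suc n}"
      then obtain r x where r: "s = r @ [x]"
        by (cases s rule: rev_cases) auto
      have len: "length r = n"
        using s by (simp add: r)
      have s_nth: "(r @ [x]) ! i \<in> B (take i (r @ [x]))" if "i < Suc n" for i
        using s that len by (simp add: r)
      have "r ! i \<in> B (take i r)" if "i < n" for i
        using s_nth[of i] that len by (simp add: nth_append)
      then have "r \<in> ?T"
        by (simp add: len)
      moreover have "x \<in> B r"
        using s_nth[of n] len by (simp add: nth_append)
      ultimately show "s \<in> (\<Union>s\<in>{s\<in>?T. length s = n}. (\<lambda>x. s @ [x]) ` B s)"
        unfolding r using len by blast
    qed
    then show ?case
      by (rule countable_subset) (intro countable_UN countable_image Suc.IH assms)
  qed
  then have "countable (\<Union>n. {s\<in>?T. length s = n})"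
    by blast
  then show ?thesis
    by (rule countable_subset[rotated]) blast
qed

text \<open>
  Two need only consider answers from a countable part of One's cover that avoids all sets chosen
  before.  The resulting tree \<open>T\<close> of positions is countable, so \<open>\<tau>\<close> can be chosen at all positions
  simultaneously such that each compact set is missed at finitely many positions only.  The
  positions along a branch are distinct, since their lengths are, so the branch following \<open>\<tau>\<close>
  misses each compact set only finitely often.
\<close>

lemma not_One_wins_if_k_hurewicz:
  assumes Z: "k_hurewicz Z"
  shows "\<not> One_wins_G_fin (k_covers Z) (groupable_members (k_covers Z))"
proof
  assume "One_wins_G_fin (k_covers Z) (groupable_members (k_covers Z))"
  then obtain \<sigma> where strat: "strategy_One (k_covers Z) \<sigma>"
    and win: "\<And>F. (\<And>n. F n \<in> finite_parts (\<sigma> (map F [0..<n])))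
                \<Longrightarrow> (\<Union>n. F n) \<notin> groupable_members (k_covers Z)"
    unfolding One_wins_G_fin_def winning_strategy_One_def by blast
  let ?L = "lists (\<Union>A\<in>k_covers Z. finite_parts A)"
  have "\<exists>\<V>. \<V> \<subseteq> \<sigma> s - \<Union>(set s) \<and> countable \<V> \<and> \<V> \<in> k_covers Z" if "s \<in> ?L" for s
  proof -
    have "finite (\<Union>(set s))"
      using that by (auto simp: finite_parts_def)
    then have "\<sigma> s - \<Union>(set s) \<in> k_covers Z"
      using strat that by (intro k_cover_Diff_finite) (auto simp: strategy_One_def)
    from k_hurewicz_countable_subcover[OF Z this] show ?thesis
      by metis
  qed
  then obtain c0 where c0: "\<And>s. s \<in> ?L \<Longrightarrow>
      c0 s \<subseteq> \<sigma> s - \<Union>(set s) \<and> countable (c0 s) \<and> c0 s \<in> k_covers Z"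
    by metis
  \<comment> \<open>With no options at illegal positions, every node of the tree \<open>T\<close> below is a legal position.\<close>
  define c where "c s = (if s \<in> ?L then c0 s else {})" for s
  have c: "c s \<subseteq> \<sigma> s - \<Union>(set s)" "countable (c s)" for s
    using c0[of s] by (auto simp: c_def)
  have cK: "c s \<in> k_covers Z" if "s \<in> ?L" for s
    using c0[of s] that by (auto simp: c_def)
  define T where "T = {s. \<forall>i<length s. s ! i \<in> finite_parts (c (take i s))}"
  have "countable (finite_parts (c s))" for s
    unfolding finite_parts_def
    by (rule countable_subset[OF _ countable_Collect_finite_subset[OF c(2)[of s]]]) auto
  then have "countable T"
    unfolding T_def by (rule countable_tree)
  have "[] \<in> T"
    by (simp add: T_def)
  have T_append: "s @ [x] \<in> T" if "s \<in> T" "x \<in> finite_parts (c s)" for s x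
    using that by (auto simp: T_def nth_append less_Suc_eq)
  have "T \<subseteq> ?L"
  proof
    fix s assume "s \<in> T"
    then show "s \<in> ?L"
    proof (induction s rule: rev_induct)
      case (snoc x s)
      have "s ! i \<in> finite_parts (c (take i s))" if "i < length s" for i
        using snoc.prems that by (auto simp: T_def nth_append dest: spec[of _ i])
      then have "s \<in> T"
        by (simp add: T_def)
      moreover have "x \<in> finite_parts (c s)"
        using snoc.prems by (auto simp: T_def dest: spec[of _ "length s"])
      ultimately show ?case
        using snoc.IH cK by auto
    qed simp
  qed
  then have cT: "c s \<in> k_covers Z" if "s \<in> T" for s
    using cK that by blast
  have "T \<noteq> {}"
    using \<open>[] \<in> T\<close> by blast
  obtain \<tau> where \<tau>: "\<And>s. s \<in> T \<Longrightarrow> \<tau> s \<in> finite_parts (c s)"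
    and cofin: "\<And>K. K \<in> compact_sets Z \<Longrightarrow> finite {s\<in>T. \<not> (\<exists>U\<in>\<tau> s. K \<subseteq> U)}"
    by (rule k_hurewicz_countable_index[OF Z \<open>countable T\<close> \<open>T \<noteq> {}\<close>, of c]) (use cT in blast)+
  define b where "b = rec_nat [] (\<lambda>_ s. s @ [\<tau> s])"
  have b0: "b 0 = []" and bS: "b (Suc n) = b n @ [\<tau> (b n)]" for n
    by (simp_all add: b_def)
  have bT: "b n \<in> T" for n
    by (induction n) (use \<open>[] \<in> T\<close> T_append \<tau> in \<open>auto simp: b0 bS\<close>)
  define F where "F n = \<tau> (b n)" for n
  have b: "b n = map F [0..<n]" for n
    by (induction n) (simp_all add: b0 bS F_def)
  have Fc: "F n \<in> finite_parts (c (b n))" for n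
    unfolding F_def by (rule \<tau>[OF bT])
  then have legal: "F n \<in> finite_parts (\<sigma> (map F [0..<n]))" for n
    using c(1)[of "b n"] by (fastforce simp: b[symmetric] finite_parts_def)
  have new: "F n \<inter> F m = {}" if "m < n" for m n
  proof -
    have "F m \<in> set (b n)"
      using that by (auto simp: b)
    then show ?thesis
      using Fc[of n] c(1)[of "b n"] by (auto simp: finite_parts_def)
  qed
  have "disjoint_family F"
    unfolding disjoint_family_on_def by (metis new inf_commute nat_neq_iff)
  moreover have "finite (F n)" for n
    using Fc by (simp add: finite_parts_def)
  moreover have "eventually_covers F K" if "K \<in> compact_sets Z" for K
  proof -
    have "inj b"
      by (rule injI) (metis b diff_zero length_map length_upt)
    then have "finite (b -` {s\<in>T. \<not> (\<exists>U\<in>\<tau> s. K \<subseteq> U)})"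
      using cofin[OF that] by (intro finite_vimageI)
    then have "finite {n. \<not> (\<exists>U\<in>F n. K \<subseteq> U)}"
      by (rule rev_finite_subset) (auto simp: F_def bT)
    then show ?thesis
      unfolding eventually_covers_cofinite .
  qed
  moreover have "(\<Union>n. F n) \<subseteq> proper_opens Z"
    using Fc k_covers_subset_proper_opens[OF cT[OF bT]] unfolding finite_parts_def by blast
  ultimately have "(\<Union>n. F n) \<in> groupable_members (k_covers Z)"
    by (subst groupable_k_cover_iff) blast+
  with win legal show False
    by blast
qed

text \<open>
  Unlike in the game, every member of the cover has to be placed in a group.  Along an enumeration
  \<open>e\<close>, the finite selection from the tail \<open>e ` {n..}\<close> lies in \<open>e ` {n..<q n}\<close>; iterating \<open>q\<close> cuts
  the enumeration into consecutive blocks, each of which contains one of the selections.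
\<close>

lemma groupable_if_countable_k_cover:
  assumes Z: "k_hurewicz Z" and \<U>: "\<U> \<in> k_covers Z" and "countable \<U>" "infinite \<U>"
  shows "\<U> \<in> groupable_members (k_covers Z)"
proof -
  define e where "e = from_nat_into \<U>"
  have e: "bij_betw e UNIV \<U>"
    unfolding e_def using assms(3,4) by (rule bij_betw_from_nat_into)
  then have "inj e" and ran: "range e = \<U>"
    by (simp_all add: bij_betw_def)
  have "e ` {n..} \<in> k_covers Z" for n
  proof -
    have "e ` {n..} = \<U> - e ` {..<n}"
      using image_set_diff[OF \<open>inj e\<close>, of UNIV "{..<n}"] ran by (simp add: Compl_eq_Diff_UNIV[symmetric])
    then show ?thesis
      using k_cover_Diff_finite[OF \<U>, of "e ` {..<n}"] by simp
  qed
  then obtain F where F: "\<And>n. F n \<in> finite_parts (e ` {n..})"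
    and ev: "\<And>K. K \<in> compact_sets Z \<Longrightarrow> eventually_covers F K"
    using k_hurewiczE[OF Z, of "\<lambda>n. e ` {n..}"] by blast
  have "\<exists>q>n. F n \<subseteq> e ` {n..<q}" for n
  proof -
    obtain I where I: "I \<subseteq> {n..}" "finite I" "F n = e ` I"
      using F[of n] finite_subset_image[of "F n" e "{n..}"] unfolding finite_parts_def by blast
    then have "I \<subseteq> {n..<Suc (Max (insert n I))}"
      by (auto simp: less_Suc_eq_le)
    then have "F n \<subseteq> e ` {n..<Suc (Max (insert n I))}"
      unfolding I(3) by (rule image_mono)
    moreover have "n < Suc (Max (insert n I))"
      using I(2) by (simp add: less_Suc_eq_le)
    ultimately show ?thesis
      by blast
  qed
  then obtain q where q: "\<And>n. q n > n" "\<And>n. F n \<subseteq> e ` {n..<q n}"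
    by metis
  define M where "M k = (q ^^ k) 0" for k
  have M0: "M 0 = 0" and MS: "M (Suc k) = q (M k)" for k
    by (simp_all add: M_def)
  have "strict_mono M"
    by (rule strict_monoI_Suc) (simp add: MS q(1))
  define G where "G k = e ` {M k..<M (Suc k)}" for k
  have "disjoint_family G"
    unfolding disjoint_family_on_def
  proof (intro ballI impI)
    fix k l :: nat assume "k \<noteq> l"
    then have "M (Suc k) \<le> M l \<or> M (Suc l) \<le> M k"
      using strict_mono_less_eq[OF \<open>strict_mono M\<close>] by (metis Suc_leI linorder_neqE_nat)
    then have "{M k..<M (Suc k)} \<inter> {M l..<M (Suc l)} = {}"
      by auto
    then show "G k \<inter> G l = {}"
      using \<open>inj e\<close> by (simp add: G_def image_Int[symmetric])
  qed
  moreover have "(\<Union>k. G k) = \<U>"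
  proof -
    have "(\<Union>k. {M k..<M (Suc k)}) = UNIV"
    proof (rule UNIV_eq_I[symmetric])
      fix i
      have "i < M (Suc i)"
        using strict_mono_imp_increasing[OF \<open>strict_mono M\<close>, of "Suc i"] by simp
      then have ex: "\<exists>k. i < M (Suc k)"
        by blast
      define k where "k = (LEAST k. i < M (Suc k))"
      have "i < M (Suc k)"
        unfolding k_def using ex by (rule LeastI_ex)
      moreover have "M k \<le> i"
      proof (cases k)
        case (Suc j)
        then have "\<not> i < M (Suc j)"
          using not_less_Least[of j "\<lambda>k. i < M (Suc k)"] by (simp add: k_def)
        then show ?thesis
          by (simp add: Suc)
      qed (simp add: M0)
      ultimately show "i \<in> (\<Union>k. {M k..<M (Suc k)})"
        by auto
    qed
    then show ?thesis
      unfolding G_def ran[symmetric] by (metis image_UN)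
  qed
  moreover have "eventually_covers G K" if K: "K \<in> compact_sets Z" for K
  proof -
    obtain m where m: "\<forall>n\<ge>m. \<exists>U\<in>F n. K \<subseteq> U"
      using ev[OF K] unfolding eventually_covers_iff by blast
    have "\<exists>U\<in>G k. K \<subseteq> U" if "k \<ge> m" for k
    proof -
      have "m \<le> M k"
        using strict_mono_imp_increasing[OF \<open>strict_mono M\<close>, of k] that by simp
      then obtain U where "U \<in> F (M k)" "K \<subseteq> U"
        using m by blast
      moreover have "F (M k) \<subseteq> G k"
        using q(2)[of "M k"] by (simp add: G_def MS)
      ultimately show ?thesis
        by blast
    qed
    then show ?thesis
      unfolding eventually_covers_iff by blast
  qed
  moreover have "finite (G k)" for k
    by (simp add: G_def)
  ultimately show ?thesis
    by (subst groupable_k_cover_iff[OF k_covers_subset_proper_opens[OF \<U>]]) blast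
qed

section \<open>The hyperspace of compact sets\<close>

text \<open>
  For open \<open>A\<close> this is a subbasic open set of the Vietoris topology; for compact \<open>A\<close> it is
  the hyperspace of \<open>A\<close>, seen inside that of \<open>X\<close>.
\<close>

definition compacts_within :: "'a topology \<Rightarrow> 'a set \<Rightarrow> 'a set set" where
  "compacts_within X A = {K \<in> compact_sets X. K \<subseteq> A}"

lemma openin_vietoris_within: "openin X U \<Longrightarrow> openin (vietoris X) (compacts_within X U)"
  unfolding vietoris_def compacts_within_def by (intro topology_generated_by_Basis) blast

lemma openin_vietoris_meets:
  "openin X U \<Longrightarrow> openin (vietoris X) {K \<in> compact_sets X. K \<inter> U \<noteq> {}}"
  unfolding vietoris_def by (intro topology_generated_by_Basis) blast

lemma compactin_finite_subcover:
  assumes "compactin X S" and "\<And>U. U \<in> \<U> \<Longrightarrow> openin X U" and "S \<subseteq> \<Union>\<U>"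
  obtains \<F> where "finite \<F>" "\<F> \<subseteq> \<U>" "S \<subseteq> \<Union>\<F>"
proof -
  have "\<exists>\<F>. finite \<F> \<and> \<F> \<subseteq> \<U> \<and> S \<subseteq> \<Union>\<F>"
    by (rule compactinD[OF assms(1)]) (fact assms)+
  then show thesis
    using that by blast
qed

lemma compactin_finite_subfamily:
  assumes "compactin X S" and "\<And>i. i \<in> I \<Longrightarrow> openin X (f i)" and "S \<subseteq> (\<Union>i\<in>I. f i)"
  obtains J where "J \<subseteq> I" "finite J" "S \<subseteq> (\<Union>i\<in>J. f i)"
proof -
  obtain \<F> where \<F>: "finite \<F>" "\<F> \<subseteq> f ` I" "S \<subseteq> \<Union>\<F>"
    by (rule compactin_finite_subcover[OF assms(1), of "f ` I"]) (use assms in auto)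
  then show thesis
    using finite_subset_image[OF \<F>(1,2)] that by blast
qed

text \<open>
  By the Alexander subbase theorem it is enough to treat covers by subbasic sets.  If the open
  sets \<open>V\<close> whose sets of meeting compacta occur in the cover do not already cover \<open>K\<close>, then the
  rest of \<open>K\<close> is a compact subset, hence a member of a set of compacta within some open \<open>W\<close>, and
  finitely many \<open>V\<close> cover what \<open>W\<close> leaves of \<open>K\<close>.
\<close>

lemma compactin_vietoris_within:
  assumes K: "compactin X K"
  shows "compactin (vietoris X) (compacts_within X K)"
proof -
  let ?in = "\<lambda>U. {L \<in> compact_sets X. L \<subseteq> U}" and ?meet = "\<lambda>U. {L \<in> compact_sets X. L \<inter> U \<noteq> {}}"
  let ?\<B> = "{?in U |U. openin X U} \<union> {?meet U |U. openin X U}"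
  let ?\<K> = "compacts_within X K"
  define Y where
    "Y = topology (arbitrary union_of (finite intersection_of (\<lambda>x. x \<in> ?\<B>) relative_to ?\<K>))"
  have topY: "topspace Y = ?\<K>"
    unfolding Y_def by (rule topspace_subbase)
  have sub\<B>: "?\<K> \<subseteq> \<Union>?\<B>"
  proof -
    have "?\<K> \<subseteq> ?in (topspace X)"
      by (auto simp: compacts_within_def compact_sets_def dest: compactin_subset_topspace)
    moreover have "?in (topspace X) \<in> ?\<B>"
      by blast
    ultimately show ?thesis
      by (rule subset_trans[OF _ Union_upper])
  qed
  have "compact_space Y"
  proof (rule Alexander_subbase_alt[OF sub\<B> _ Y_def[symmetric]])
    fix \<C> assume \<C>: "\<C> \<subseteq> ?\<B>" "?\<K> \<subseteq> \<Union>\<C>"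
    define \<V> where "\<V> = {V. openin X V \<and> ?meet V \<in> \<C>}"
    \<comment> \<open>A compact subset of \<open>K\<close> either lies in \<open>W\<close> or meets one of the finitely many other sets
      covering \<open>K\<close>.\<close>
    have reduce: "\<exists>\<C>'. finite \<C>' \<and> \<C>' \<subseteq> \<C> \<and> ?\<K> \<subseteq> \<Union>\<C>'"
      if W: "openin X W" "K \<subseteq> W \<union> \<Union>\<V>" and \<D>: "\<D> \<subseteq> \<C>" "finite \<D>" "?in W \<subseteq> \<Union>\<D>" for W \<D>
    proof -
      obtain \<F> where \<F>: "finite \<F>" "\<F> \<subseteq> insert W \<V>" "K \<subseteq> \<Union>\<F>"
        using compactinD[OF K, of "insert W \<V>"] W by (auto simp: \<V>_def)
      let ?\<C>' = "\<D> \<union> ?meet ` (\<F> - {W})"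
      have "L \<in> \<Union>?\<C>'" if L: "L \<in> ?\<K>" for L
      proof (cases "L \<subseteq> W")
        case True
        then show ?thesis
          using L \<D>(3) by (auto simp: compacts_within_def)
      next
        case False
        then obtain x where x: "x \<in> L" "x \<notin> W"
          by blast
        moreover have "L \<subseteq> K"
          using L by (simp add: compacts_within_def)
        ultimately obtain V where V: "V \<in> \<F>" "x \<in> V"
          using \<F>(3) by blast
        with x have "V \<in> \<F> - {W}"
          by blast
        moreover have "L \<in> ?meet V"
          using L x(1) V(2) by (auto simp: compacts_within_def)
        ultimately show ?thesis
          by blast
      qed
      moreover have "finite ?\<C>'" "?\<C>' \<subseteq> \<C>"
        using \<D> \<F> by (auto simp: \<V>_def)
      ultimately show ?thesis
        by (intro exI[of _ ?\<C>']) blast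
    qed
    show "\<exists>\<C>'. finite \<C>' \<and> \<C>' \<subseteq> \<C> \<and> ?\<K> \<subseteq> \<Union>\<C>'"
    proof (cases "K \<subseteq> \<Union>\<V>")
      case True
      then show ?thesis
        by (intro reduce[of "{}" "{}"]) (auto simp: compact_sets_def)
    next
      case False
      have "openin X (\<Union>\<V>)"
        by (auto simp: \<V>_def)
      then have "compactin X ((topspace X - \<Union>\<V>) \<inter> K)"
        using K by (intro closed_Int_compactin) auto
      moreover have eq: "(topspace X - \<Union>\<V>) \<inter> K = K - \<Union>\<V>"
        using compactin_subset_topspace[OF K] by blast
      ultimately have "K - \<Union>\<V> \<in> ?\<K>"
        using False by (auto simp: compacts_within_def compact_sets_def)
      then obtain C where C: "C \<in> \<C>" "K - \<Union>\<V> \<in> C"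
        using \<C>(2) by blast
      have not_meet: "C \<noteq> ?meet V" if "openin X V" for V
        using C that by (auto simp: \<V>_def)
      have "C \<in> ?\<B>"
        using \<C>(1) C(1) by (rule subsetD)
      then obtain W where W: "openin X W" "C = ?in W"
      proof (elim UnE CollectE exE conjE)
        fix V assume "C = ?meet V" "openin X V"
        with not_meet show thesis
          by blast
      qed
      then have "K \<subseteq> W \<union> \<Union>\<V>"
        using C(2) by blast
      then show ?thesis
        using C(1) W by (intro reduce[of W "{C}"]) simp_all
    qed
  qed
  moreover have "continuous_map Y (vietoris X) (\<lambda>L. L)"
    unfolding vietoris_def
  proof (rule continuous_on_generated_topo)
    show "(\<lambda>L. L) ` topspace Y \<subseteq> \<Union>?\<B>"
      using sub\<B> topY by simp
    fix B assume "B \<in> ?\<B>"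
    then have "(finite intersection_of (\<lambda>x. x \<in> ?\<B>)) B"
      by (rule finite_intersection_of_inc)
    then have "(finite intersection_of (\<lambda>x. x \<in> ?\<B>) relative_to ?\<K>) (?\<K> \<inter> B)"
      by (rule relative_to_inc)
    then have "openin Y (?\<K> \<inter> B)"
      unfolding Y_def openin_subbase by (rule arbitrary_union_of_inc)
    then show "openin Y ((\<lambda>L. L) -` B \<inter> topspace Y)"
      by (simp add: topY Int_commute)
  qed
  ultimately have "compactin (vietoris X) ((\<lambda>L. L) ` topspace Y)"
    by (intro image_compactin[of Y]) (simp_all add: compact_space_def)
  then show ?thesis
    by (simp add: topY)
qed

text \<open>
  For a finite family \<open>\<G>\<close> of open sets, the compacta \<open>M\<close> in this relation to \<open>L\<close> form a basic
  Vietoris neighbourhood of \<open>L\<close>, namely the one given by the members of \<open>\<G>\<close> that contain or meet \<open>L\<close>.  The relation is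
  not symmetric: \<open>M\<close> may pass more tests than \<open>L\<close>.
\<close>

definition same_pattern :: "'a set set \<Rightarrow> 'a set \<Rightarrow> 'a set \<Rightarrow> bool" where
  "same_pattern \<G> L M \<longleftrightarrow>
     (\<forall>G\<in>\<G>. (L \<subseteq> G \<longrightarrow> M \<subseteq> G) \<and> (L \<inter> G \<noteq> {} \<longrightarrow> M \<inter> G \<noteq> {}))"

lemma same_pattern_subset: "same_pattern \<G> L M \<Longrightarrow> G \<in> \<G> \<Longrightarrow> L \<subseteq> G \<Longrightarrow> M \<subseteq> G"
  by (simp add: same_pattern_def)

lemma same_pattern_meets: "same_pattern \<G> L M \<Longrightarrow> G \<in> \<G> \<Longrightarrow> L \<inter> G \<noteq> {} \<Longrightarrow> M \<inter> G \<noteq> {}"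
  by (simp add: same_pattern_def)

lemma vietoris_open_pattern:
  assumes "openin (vietoris X) W" and "L \<in> W"
  shows "\<exists>\<G>. finite \<G> \<and> (\<forall>G\<in>\<G>. openin X G) \<and>
           (\<forall>M\<in>compact_sets X. same_pattern \<G> L M \<longrightarrow> M \<in> W)"
proof -
  have "generate_topology_on
     ({{K \<in> compact_sets X. K \<subseteq> U} |U. openin X U} \<union>
      {{K \<in> compact_sets X. K \<inter> U \<noteq> {}} |U. openin X U}) W"
    using assms(1) unfolding vietoris_def by (rule openin_topology_generated_by)
  then show ?thesis
    using assms(2)
  proof (induction W)
    case (Int a b)
    then have "L \<in> a" "L \<in> b"
      by simp_all
    from Int.IH(1)[OF this(1)] Int.IH(2)[OF this(2)]
    obtain \<G> \<H> where \<G>: "finite \<G>" "\<forall>G\<in>\<G>. openin X G"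
        "\<forall>M\<in>compact_sets X. same_pattern \<G> L M \<longrightarrow> M \<in> a"
      and \<H>: "finite \<H>" "\<forall>G\<in>\<H>. openin X G"
        "\<forall>M\<in>compact_sets X. same_pattern \<H> L M \<longrightarrow> M \<in> b"
      by (elim exE conjE)
    have "same_pattern \<G> L M \<and> same_pattern \<H> L M" if "same_pattern (\<G> \<union> \<H>) L M" for M
      using that by (simp add: same_pattern_def)
    with \<G> \<H> show ?case
      by (intro exI[of _ "\<G> \<union> \<H>"]) auto
  next
    case (UN \<W>)
    then obtain a where a: "a \<in> \<W>" "L \<in> a"
      by blast
    from UN.IH[OF this] obtain \<G> where "finite \<G>" "\<forall>G\<in>\<G>. openin X G"
        "\<forall>M\<in>compact_sets X. same_pattern \<G> L M \<longrightarrow> M \<in> a"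
      by (elim exE conjE)
    then show ?case
      using a(1) by (intro exI[of _ \<G>]) auto
  next
    case (Basis s)
    then obtain U where U: "openin X U"
      and s: "s = {K \<in> compact_sets X. K \<subseteq> U} \<or> s = {K \<in> compact_sets X. K \<inter> U \<noteq> {}}"
      by (elim UnE CollectE exE conjE) blast+
    have "M \<in> s" if "M \<in> compact_sets X" "same_pattern {U} L M" for M
      using s Basis.prems that by (auto simp: same_pattern_def)
    then show ?case
      using U by (intro exI[of _ "{U}"]) auto
  qed simp
qed

lemma openin_vietoris_same_pattern:
  assumes "finite \<G>" and "\<And>G. G \<in> \<G> \<Longrightarrow> openin X G"
  shows "openin (vietoris X) {M \<in> compact_sets X. same_pattern \<G> L M}"
  using assms
proof (induction \<G>)
  case empty
  show ?case
    using openin_topspace[of "vietoris X"] by (simp add: same_pattern_def topspace_vietoris)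
next
  case (insert G \<G>)
  define upper where "upper = (if L \<subseteq> G then compacts_within X G else topspace (vietoris X))"
  define lower where "lower = (if L \<inter> G \<noteq> {} then {M \<in> compact_sets X. M \<inter> G \<noteq> {}}
    else topspace (vietoris X))"
  have "openin X G" and IH: "openin (vietoris X) {M \<in> compact_sets X. same_pattern \<G> L M}"
    using insert by simp_all
  then have "openin (vietoris X) upper" "openin (vietoris X) lower"
    by (simp_all add: upper_def lower_def openin_vietoris_within openin_vietoris_meets)
  then have "openin (vietoris X) (upper \<inter> lower \<inter> {M \<in> compact_sets X. same_pattern \<G> L M})"
    using IH by (intro openin_Int)
  also have "upper \<inter> lower \<inter> {M \<in> compact_sets X. same_pattern \<G> L M} =
      {M \<in> compact_sets X. same_pattern (insert G \<G>) L M}"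
    by (rule set_eqI)
      (simp add: upper_def lower_def same_pattern_def topspace_vietoris compacts_within_def conj_ac)
  finally show ?case .
qed

text \<open>
  By compactness, finitely many basic neighbourhoods inside \<open>W\<close> cover the compact subsets of \<open>K\<close>;
  let \<open>\<G>\<close> be the finite family of all open sets that occur in them.  Let \<open>cell x\<close> be the
  intersection of the members of \<open>\<G>\<close> that contain \<open>x\<close>; only finitely many cells occur.  A compact set \<open>M\<close> inside the union of the cells is compared with the finite set of
  representatives in \<open>K\<close> of those cells that \<open>M\<close> meets.  That finite set lies in one of the
  neighbourhoods, and \<open>M\<close> is contained in, or meets, every member of \<open>\<G>\<close> that contains, or meets, it.
\<close>

lemma vietoris_tube:
  assumes K: "K \<in> compact_sets X" and W: "openin (vietoris X) W" and sub: "compacts_within X K \<subseteq> W"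
  obtains U where "openin X U" "K \<subseteq> U" "compacts_within X U \<subseteq> W"
proof -
  have Kc: "compactin X K" and KX: "K \<subseteq> topspace X"
    using K by (auto simp: compact_sets_def compactin_subset_topspace)
  obtain g where g: "\<And>L. L \<in> W \<Longrightarrow> finite (g L)" "\<And>L G. L \<in> W \<Longrightarrow> G \<in> g L \<Longrightarrow> openin X G"
    "\<And>L M. L \<in> W \<Longrightarrow> M \<in> compact_sets X \<Longrightarrow> same_pattern (g L) L M \<Longrightarrow> M \<in> W"
    using vietoris_open_pattern[OF W] by metis
  let ?\<K> = "compacts_within X K"
  let ?N = "\<lambda>L. {M \<in> compact_sets X. same_pattern (g L) L M}"
  have cov: "?\<K> \<subseteq> (\<Union>L\<in>?\<K>. ?N L)"
    by (auto simp: compacts_within_def same_pattern_def)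
  have opN: "openin (vietoris X) (?N L)" if "L \<in> ?\<K>" for L
    using that sub g(1,2) by (intro openin_vietoris_same_pattern) blast+
  obtain \<L> where \<L>: "\<L> \<subseteq> ?\<K>" "finite \<L>" "?\<K> \<subseteq> (\<Union>L\<in>\<L>. ?N L)"
    using compactin_finite_subfamily[OF compactin_vietoris_within[OF Kc] opN cov] .
  define \<G> where "\<G> = (\<Union>L\<in>\<L>. g L)"
  have fin\<G>: "finite \<G>" and op\<G>: "\<And>G. G \<in> \<G> \<Longrightarrow> openin X G"
    using \<L> sub g(1,2) by (auto simp: \<G>_def)
  define cell where "cell x = topspace X \<inter> \<Inter>{G\<in>\<G>. x \<in> G}" for x
  have opcell: "openin X (cell x)" for x
    unfolding cell_def using fin\<G> op\<G> by (intro openin_Int_Inter) auto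
  have cell_sub: "cell x \<subseteq> G" if "G \<in> \<G>" "x \<in> G" for x G
    using that by (auto simp: cell_def)
  have "finite (cell ` K)"
  proof (rule finite_subset)
    show "cell ` K \<subseteq> (\<lambda>\<H>. topspace X \<inter> \<Inter>\<H>) ` Pow \<G>"
      by (auto simp: cell_def)
  qed (use fin\<G> in simp)
  then obtain R where R: "R \<subseteq> K" "finite R" "cell ` K = cell ` R"
    using finite_subset_image[of "cell ` K" cell K] by blast
  have "M \<in> W" if M: "M \<in> compacts_within X (\<Union>(cell ` K))" for M
  proof -
    have Mc: "M \<in> compact_sets X" and Msub: "M \<subseteq> \<Union>(cell ` R)"
      using M R(3) by (auto simp: compacts_within_def)
    let ?L = "{x\<in>R. cell x \<inter> M \<noteq> {}}"
    have "?L \<noteq> {}"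
      using Mc Msub by (auto simp: compact_sets_def)
    then have "?L \<in> ?\<K>"
      using R KX by (auto simp: compacts_within_def compact_sets_def intro!: finite_imp_compactin)
    then obtain L where L: "L \<in> \<L>" "same_pattern (g L) L ?L"
      using \<L>(3) by blast
    have "same_pattern (g L) L M"
      unfolding same_pattern_def
    proof (intro ballI conjI impI)
      fix G assume "G \<in> g L"
      then have G: "G \<in> \<G>"
        using L(1) by (auto simp: \<G>_def)
      show "M \<subseteq> G" if "L \<subseteq> G"
      proof
        fix y assume "y \<in> M"
        with Msub obtain x where "x \<in> R" "y \<in> cell x"
          by blast
        moreover from this \<open>y \<in> M\<close> have "x \<in> ?L"
          by blast
        then have "x \<in> G"
          using same_pattern_subset[OF L(2) \<open>G \<in> g L\<close> that] by blast
        ultimately show "y \<in> G"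
          using cell_sub[OF G] by blast
      qed
      show "M \<inter> G \<noteq> {}" if LG: "L \<inter> G \<noteq> {}"
      proof -
        obtain x where "x \<in> ?L" "x \<in> G"
          using same_pattern_meets[OF L(2) \<open>G \<in> g L\<close> LG] by blast
        then show ?thesis
          using cell_sub[OF G, of x] by blast
      qed
    qed
    then show ?thesis
      using g(3)[of L M] L(1) \<L>(1) sub Mc by blast
  qed
  moreover have "K \<subseteq> \<Union>(cell ` K)"
    using KX by (auto simp: cell_def)
  moreover have "openin X (\<Union>(cell ` K))"
    using opcell by (intro openin_Union) auto
  ultimately show thesis
    using that by blast
qed

text \<open>
  Given an open cover of the union, the sets \<open>compacts_within X (\<Union>\<F>)\<close> for finite subfamilies \<open>\<F>\<close>
  cover \<open>\<K>\<close>; finitely many of them suffice, and their subfamilies combine to a finite one.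
\<close>

lemma compact_Union_vietoris:
  assumes "\<K> \<in> compact_sets (vietoris X)"
  shows "\<Union>\<K> \<in> compact_sets X"
proof -
  have comp: "compactin (vietoris X) \<K>" and "\<K> \<noteq> {}"
    using assms by (auto simp: compact_sets_def)
  have \<K>: "K \<in> compact_sets X" if "K \<in> \<K>" for K
    using compactin_subset_topspace[OF comp] that by (auto simp: topspace_vietoris)
  have "compactin X (\<Union>\<K>)"
    unfolding compactin_def
  proof (intro conjI allI impI)
    show "\<Union>\<K> \<subseteq> topspace X"
      using \<K> by (auto simp: compact_sets_def dest!: compactin_subset_topspace)
    fix \<U> assume \<U>: "(\<forall>U\<in>\<U>. openin X U) \<and> \<Union>\<K> \<subseteq> \<Union>\<U>"
    let ?I = "{\<F>. finite \<F> \<and> \<F> \<subseteq> \<U>}"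
    have cov: "\<K> \<subseteq> (\<Union>\<F>\<in>?I. compacts_within X (\<Union>\<F>))"
    proof
      fix K assume K: "K \<in> \<K>"
      then have KU: "compactin X K" "K \<subseteq> \<Union>\<U>"
        using \<K> \<U> by (auto simp: compact_sets_def)
      obtain \<F> where "finite \<F>" "\<F> \<subseteq> \<U>" "K \<subseteq> \<Union>\<F>"
        by (rule compactin_finite_subcover[of X K \<U>]) (use \<U> KU in auto)
      then show "K \<in> (\<Union>\<F>\<in>?I. compacts_within X (\<Union>\<F>))"
        using \<K>[OF K] by (auto simp: compacts_within_def)
    qed
    have "openin (vietoris X) (compacts_within X (\<Union>\<F>))" if "\<F> \<in> ?I" for \<F>
      using that \<U> by (intro openin_vietoris_within openin_Union) auto
    from compactin_finite_subfamily[OF comp this cov]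
    obtain \<Phi> where \<Phi>: "\<Phi> \<subseteq> ?I" "finite \<Phi>" "\<K> \<subseteq> (\<Union>\<F>\<in>\<Phi>. compacts_within X (\<Union>\<F>))" .
    have "finite (\<Union>\<Phi>)" "\<Union>\<Phi> \<subseteq> \<U>"
      using \<Phi>(1,2) by auto
    moreover have "\<Union>\<K> \<subseteq> \<Union>(\<Union>\<Phi>)"
    proof
      fix x assume "x \<in> \<Union>\<K>"
      then obtain K where K: "x \<in> K" "K \<in> \<K>"
        by (rule UnionE)
      then obtain \<F> where "\<F> \<in> \<Phi>" "K \<in> compacts_within X (\<Union>\<F>)"
        using subsetD[OF \<Phi>(3) K(2)] by (elim UN_E)
      then show "x \<in> \<Union>(\<Union>\<Phi>)"
        using K(1) by (auto simp: compacts_within_def)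
    qed
    ultimately show "\<exists>\<F>. finite \<F> \<and> \<F> \<subseteq> \<U> \<and> \<Union>\<K> \<subseteq> \<Union>\<F>"
      by blast
  qed
  moreover have "\<Union>\<K> \<noteq> {}"
    using \<K> \<open>\<K> \<noteq> {}\<close> by (auto simp: compact_sets_def)
  ultimately show ?thesis
    by (simp add: compact_sets_def)
qed

section \<open>Transfer between a space and its hyperspace\<close>

text \<open>Singletons of points inside and outside \<open>U\<close> show that properness is preserved.\<close>

lemma compacts_within_proper:
  assumes "U \<in> proper_opens X"
  shows "compacts_within X U \<in> proper_opens (vietoris X)"
proof -
  obtain x y where "x \<in> U" "y \<in> topspace X - U" and U: "openin X U"
    using assms by (auto simp: proper_opens_def dest: openin_subset)
  moreover from this have "x \<in> topspace X"
    using openin_subset by blast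
  ultimately have "{x} \<in> compacts_within X U" "{y} \<in> compact_sets X - compacts_within X U"
    by (auto simp: compacts_within_def compact_sets_def)
  then show ?thesis
    using openin_vietoris_within[OF U] by (auto simp: proper_opens_def topspace_vietoris)
qed

lemma finite_parts_image:
  assumes "F \<in> finite_parts (f ` A)"
  shows "\<exists>H\<in>finite_parts A. F = f ` H"
proof -
  from assms obtain H where "H \<subseteq> A" "finite H" "F = f ` H"
    using finite_subset_image[of F f A] unfolding finite_parts_def by blast
  then show ?thesis
    using assms by (auto simp: finite_parts_def)
qed

lemma hurewiczE:
  fixes \<U> :: "nat \<Rightarrow> 'a set set"
  assumes "hurewicz Z" and "\<And>n. \<U> n \<in> open_covers Z"
  obtains \<F> where "\<And>n. \<F> n \<in> finite_parts (\<U> n)"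
    and "\<And>z. z \<in> topspace Z \<Longrightarrow> \<exists>m. \<forall>n\<ge>m. z \<in> \<Union>(\<F> n)"
proof -
  obtain \<F> where "(\<forall>n. \<F> n \<in> finite_parts (\<U> n)) \<and>
      (\<forall>z\<in>topspace Z. \<exists>m. \<forall>n\<ge>m. z \<in> \<Union>(\<F> n))"
    using assms unfolding hurewicz_def by meson
  then show thesis
    using that[of \<F>] by meson
qed

lemma hurewicz_hyperspace_imp_k_hurewicz:
  assumes "hurewicz (vietoris X)"
  shows "k_hurewicz X"
  unfolding k_hurewicz_def
proof (intro allI impI)
  fix \<U> :: "nat \<Rightarrow> 'a set set"
  assume \<U>: "\<forall>n. \<U> n \<in> k_covers X"
  have "compacts_within X ` \<U> n \<in> open_covers (vietoris X)" for n
  proof -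
    have "compacts_within X ` \<U> n \<subseteq> proper_opens (vietoris X)"
      using k_covers_subset_proper_opens[OF spec[OF \<U>]] compacts_within_proper by blast
    moreover have "\<Union>(compacts_within X ` \<U> n) = topspace (vietoris X)"
    proof
      show "topspace (vietoris X) \<subseteq> \<Union>(compacts_within X ` \<U> n)"
      proof
        fix K assume "K \<in> topspace (vietoris X)"
        then have K: "K \<in> compact_sets X"
          by (simp add: topspace_vietoris)
        have "\<U> n \<in> k_covers X"
          using \<U> by blast
        from k_coversD[OF this K] obtain U where "U \<in> \<U> n" "K \<subseteq> U"
          by metis
        then show "K \<in> \<Union>(compacts_within X ` \<U> n)"
          using K by (auto simp: compacts_within_def)
      qed
    qed (auto simp: topspace_vietoris compacts_within_def)
    ultimately show ?thesis
      by (simp add: open_covers_def)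
  qed
  from hurewiczE[OF assms, of "\<lambda>n. compacts_within X ` \<U> n", OF this]
  obtain \<F> where \<F>: "\<And>n. \<F> n \<in> finite_parts (compacts_within X ` \<U> n)"
    and ev: "\<And>K. K \<in> compact_sets X \<Longrightarrow> \<exists>m. \<forall>n\<ge>m. K \<in> \<Union>(\<F> n)"
    unfolding topspace_vietoris by metis
  have "\<exists>H\<in>finite_parts (\<U> n). \<F> n = compacts_within X ` H" for n
    using \<F> by (rule finite_parts_image)
  then obtain H where H: "\<And>n. H n \<in> finite_parts (\<U> n)" "\<And>n. \<F> n = compacts_within X ` H n"
    by metis
  have "eventually_covers H K" if "K \<in> compact_sets X" for K
    unfolding eventually_covers_def
  proof (rule eventually_mono)
    show "\<forall>\<^sub>F n in sequentially. K \<in> \<Union>(\<F> n)"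
      using ev[OF that] by (simp add: eventually_sequentially)
  qed (auto simp: H(2) compacts_within_def)
  with H(1) show "\<exists>F. (\<forall>n. F n \<in> finite_parts (\<U> n)) \<and> (\<forall>K\<in>compact_sets X. eventually_covers F K)"
    by blast
qed

lemma k_hurewicz_hyperspace_imp_k_hurewicz:
  assumes "k_hurewicz (vietoris X)"
  shows "k_hurewicz X"
  unfolding k_hurewicz_def
proof (intro allI impI)
  fix \<U> :: "nat \<Rightarrow> 'a set set"
  assume \<U>: "\<forall>n. \<U> n \<in> k_covers X"
  have "compacts_within X ` \<U> n \<in> k_covers (vietoris X)" for n
  proof (rule k_coversI)
    show "compacts_within X ` \<U> n \<subseteq> proper_opens (vietoris X)"
      using k_covers_subset_proper_opens[OF spec[OF \<U>]] compacts_within_proper by blast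
    fix \<K> assume \<K>: "\<K> \<in> compact_sets (vietoris X)"
    then have "\<K> \<subseteq> compact_sets X"
      unfolding compact_sets_def[of "vietoris X"]
      using compactin_subset_topspace topspace_vietoris by blast
    moreover have "\<U> n \<in> k_covers X"
      using \<U> by blast
    then obtain U where "U \<in> \<U> n" "\<Union>\<K> \<subseteq> U"
      using k_coversD[OF _ compact_Union_vietoris[OF \<K>]] by metis
    ultimately show "\<exists>W\<in>compacts_within X ` \<U> n. \<K> \<subseteq> W"
      by (auto simp: compacts_within_def)
  qed
  from k_hurewiczE[OF assms, of "\<lambda>n. compacts_within X ` \<U> n", OF this]
  obtain \<F> where \<F>: "\<And>n. \<F> n \<in> finite_parts (compacts_within X ` \<U> n)"
    and ev: "\<And>\<K>. \<K> \<in> compact_sets (vietoris X) \<Longrightarrow> eventually_covers \<F> \<K>"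
    by metis
  have "\<exists>H\<in>finite_parts (\<U> n). \<F> n = compacts_within X ` H" for n
    using \<F> by (rule finite_parts_image)
  then obtain H where H: "\<And>n. H n \<in> finite_parts (\<U> n)" "\<And>n. \<F> n = compacts_within X ` H n"
    by metis
  have "eventually_covers H K" if "K \<in> compact_sets X" for K
  proof -
    have "{K} \<in> compact_sets (vietoris X)"
      using that by (simp add: compact_sets_def[of "vietoris X"] topspace_vietoris)
    from ev[OF this] show ?thesis
      unfolding eventually_covers_def H(2)
      by (rule eventually_mono) (auto simp: compacts_within_def)
  qed
  with H(1) show "\<exists>F. (\<forall>n. F n \<in> finite_parts (\<U> n)) \<and> (\<forall>K\<in>compact_sets X. eventually_covers F K)"
    by blast
qed

text \<open>
  The open sets \<open>U\<close> whose compact subsets all lie in one member of \<open>\<W> n\<close> form a k-cover of \<open>X\<close>.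
  The separation axiom and non-compactness make these \<open>U\<close> proper: the set
  supplied by \<open>vietoris_tube\<close> might be the whole space, in which case a point outside \<open>K\<close> is
  removed from it.
\<close>

lemma k_hurewicz_select_traces:
  assumes X: "k_hurewicz X" and "Hausdorff_space X" and "\<not> compact_space X"
    and op: "\<And>n W. W \<in> \<W> n \<Longrightarrow> openin (vietoris X) W"
    and tr: "\<And>n K. K \<in> compact_sets X \<Longrightarrow> \<exists>W\<in>\<W> n. compacts_within X K \<subseteq> W"
  obtains F where "\<And>n. F n \<in> finite_parts (\<W> n)"
    and "\<And>K. K \<in> compact_sets X \<Longrightarrow>
      \<forall>\<^sub>F n in sequentially. \<exists>W\<in>F n. compacts_within X K \<subseteq> W"
proof -
  define \<U> where "\<U> n = {U \<in> proper_opens X. \<exists>W\<in>\<W> n. compacts_within X U \<subseteq> W}" for n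
  have "\<U> n \<in> k_covers X" for n
  proof (rule k_coversI)
    fix K assume K: "K \<in> compact_sets X"
    obtain W where W: "W \<in> \<W> n" "compacts_within X K \<subseteq> W"
      using tr[OF K] by blast
    obtain U where U: "openin X U" "K \<subseteq> U" "compacts_within X U \<subseteq> W"
      using vietoris_tube[OF K op[OF W(1)] W(2)] by blast
    have "K \<noteq> topspace X" "K \<subseteq> topspace X"
      using K \<open>\<not> compact_space X\<close>
      by (auto simp: compact_sets_def compact_space_def dest: compactin_subset_topspace)
    then obtain x where x: "x \<in> topspace X" "x \<notin> K"
      by blast
    have "closedin X {x}"
      using x(1) \<open>Hausdorff_space X\<close> by (simp add: closedin_Hausdorff_singleton)
    then have "openin X (U - {x})"
      using U(1) by (rule openin_diff[rotated])
    moreover have "K \<subseteq> U - {x}" "K \<noteq> {}"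
      using U(2) x(2) K by (auto simp: compact_sets_def)
    ultimately have "U - {x} \<in> proper_opens X"
      using x(1) by (auto simp: proper_opens_def)
    moreover have "compacts_within X (U - {x}) \<subseteq> W"
      using U(3) by (auto simp: compacts_within_def)
    ultimately show "\<exists>U\<in>\<U> n. K \<subseteq> U"
      using W(1) \<open>K \<subseteq> U - {x}\<close> unfolding \<U>_def by blast
  qed (auto simp: \<U>_def)
  from k_hurewiczE[OF X, of \<U>, OF this]
  obtain H where H: "\<And>n. H n \<in> finite_parts (\<U> n)"
    and ev: "\<And>K. K \<in> compact_sets X \<Longrightarrow> eventually_covers H K"
    by metis
  have "\<forall>n U. \<exists>W. U \<in> \<U> n \<longrightarrow> W \<in> \<W> n \<and> compacts_within X U \<subseteq> W"
    by (auto simp: \<U>_def)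
  then obtain w where w: "\<And>n U. U \<in> \<U> n \<Longrightarrow> w n U \<in> \<W> n \<and> compacts_within X U \<subseteq> w n U"
    by metis
  have "w n ` H n \<in> finite_parts (\<W> n)" for n
    using H[of n] w by (auto simp: finite_parts_def)
  moreover have "\<forall>\<^sub>F n in sequentially. \<exists>W\<in>w n ` H n. compacts_within X K \<subseteq> W"
    if "K \<in> compact_sets X" for K
    using ev[OF that] unfolding eventually_covers_def
  proof (rule eventually_mono)
    fix n assume "\<exists>U\<in>H n. K \<subseteq> U"
    then obtain U where "U \<in> H n" "K \<subseteq> U" by blast
    moreover from this have "compacts_within X U \<subseteq> w n U"
      using H[of n] w by (auto simp: finite_parts_def)
    ultimately show "\<exists>W\<in>w n ` H n. compacts_within X K \<subseteq> W"
      by (fastforce simp: compacts_within_def)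
  qed
  ultimately show thesis
    using that[of "\<lambda>n. w n ` H n"] by blast
qed

lemma mem_compacts_within_self: "K \<in> compact_sets X \<Longrightarrow> K \<in> compacts_within X K"
  by (simp add: compacts_within_def)

text \<open>
  A member of an open cover of the hyperspace need not contain all compact subsets of a given \<open>K\<close>,
  but these form a compact set, so finite unions of members do.
\<close>

lemma k_hurewicz_imp_hurewicz_hyperspace:
  assumes X: "k_hurewicz X" "Hausdorff_space X" "\<not> compact_space X"
  shows "hurewicz (vietoris X)"
  unfolding hurewicz_def
proof (intro allI impI)
  fix \<U> :: "nat \<Rightarrow> 'a set set set"
  assume \<U>: "\<forall>n. \<U> n \<in> open_covers (vietoris X)"
  define \<W> where "\<W> n = {\<Union>\<E> |\<E>. \<E> \<in> finite_parts (\<U> n)}" for n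
  have op: "openin (vietoris X) U" if "U \<in> \<U> n" for U n
    using \<U> that by (auto simp: open_covers_def proper_opens_def)
  have 1: "openin (vietoris X) W" if "W \<in> \<W> n" for W n
    using that op by (auto simp: \<W>_def finite_parts_def intro!: openin_Union)
  have 2: "\<exists>W\<in>\<W> n. compacts_within X K \<subseteq> W" if K: "K \<in> compact_sets X" for K n
  proof -
    have cov: "compacts_within X K \<subseteq> \<Union>(\<U> n)"
      using \<U> by (auto simp: open_covers_def topspace_vietoris compacts_within_def)
    have "compactin (vietoris X) (compacts_within X K)"
      using K by (intro compactin_vietoris_within) (simp add: compact_sets_def)
    from compactin_finite_subcover[OF this op cov]
    obtain \<E> where \<E>: "finite \<E>" "\<E> \<subseteq> \<U> n" "compacts_within X K \<subseteq> \<Union>\<E>" .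
    moreover have "\<E> \<noteq> {}"
      using \<E>(3) mem_compacts_within_self[OF K] by auto
    ultimately show ?thesis
      unfolding \<W>_def finite_parts_def by blast
  qed
  obtain F where F: "\<And>n. F n \<in> finite_parts (\<W> n)"
    and ev: "\<And>K. K \<in> compact_sets X \<Longrightarrow>
      \<forall>\<^sub>F n in sequentially. \<exists>W\<in>F n. compacts_within X K \<subseteq> W"
    by (rule k_hurewicz_select_traces[OF X, of \<W>]) (erule 1, erule 2, rule that, blast+)
  have "\<forall>n W. \<exists>\<E>. W \<in> \<W> n \<longrightarrow> \<E> \<in> finite_parts (\<U> n) \<and> W = \<Union>\<E>"
    by (auto simp: \<W>_def)
  then obtain \<epsilon> where \<epsilon>: "\<And>n W. W \<in> \<W> n \<Longrightarrow> \<epsilon> n W \<in> finite_parts (\<U> n) \<and> W = \<Union>(\<epsilon> n W)"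
    by metis
  define \<F> where "\<F> n = \<Union>(\<epsilon> n ` F n)" for n
  have "\<F> n \<in> finite_parts (\<U> n)" for n
  proof -
    have F': "finite (F n)" "F n \<noteq> {}" "F n \<subseteq> \<W> n"
      using F[of n] by (simp_all add: finite_parts_def)
    then have \<epsilon>F: "\<epsilon> n W \<subseteq> \<U> n" "finite (\<epsilon> n W)" "\<epsilon> n W \<noteq> {}" if "W \<in> F n" for W
      using that \<epsilon>[of W n] by (auto simp: finite_parts_def)
    have "finite (\<F> n)"
      using F'(1) \<epsilon>F(2) by (auto simp: \<F>_def)
    moreover have "\<F> n \<subseteq> \<U> n"
      using \<epsilon>F(1) by (auto simp: \<F>_def)
    moreover have "\<F> n \<noteq> {}"
      using F'(2) \<epsilon>F(3) by (auto simp: \<F>_def)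
    ultimately show ?thesis
      by (simp add: finite_parts_def)
  qed
  moreover have "\<exists>m. \<forall>n\<ge>m. K \<in> \<Union>(\<F> n)" if "K \<in> topspace (vietoris X)" for K
  proof -
    have K: "K \<in> compact_sets X"
      using that by (simp add: topspace_vietoris)
    have "K \<in> \<Union>(\<F> n)" if W: "\<exists>W\<in>F n. compacts_within X K \<subseteq> W" for n
    proof -
      obtain W where W: "W \<in> F n" "K \<in> W"
        using W mem_compacts_within_self[OF K] by blast
      then have "W \<in> \<W> n"
        using F[of n] by (auto simp: finite_parts_def)
      then have "W = \<Union>(\<epsilon> n W)"
        using \<epsilon> by blast
      then obtain U where "U \<in> \<epsilon> n W" "K \<in> U"
        using W(2) by (metis UnionE)
      then show ?thesis
        using W(1) by (auto simp: \<F>_def)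
    qed
    from eventually_mono[OF ev[OF K] this] show ?thesis
      by (simp add: eventually_sequentially)
  qed
  ultimately show "\<exists>\<F>. (\<forall>n. \<F> n \<in> finite_parts (\<U> n)) \<and>
      (\<forall>z\<in>topspace (vietoris X). \<exists>m. \<forall>n\<ge>m. z \<in> \<Union>(\<F> n))"
    by blast
qed

lemma k_hurewicz_imp_k_hurewicz_hyperspace:
  assumes X: "k_hurewicz X" "Hausdorff_space X" "\<not> compact_space X"
  shows "k_hurewicz (vietoris X)"
  unfolding k_hurewicz_def
proof (intro allI impI)
  fix \<W> :: "nat \<Rightarrow> 'a set set set"
  assume \<W>: "\<forall>n. \<W> n \<in> k_covers (vietoris X)"
  have 1: "openin (vietoris X) W" if "W \<in> \<W> n" for W n
    using \<W> that k_covers_subset_proper_opens by (fastforce simp: proper_opens_def)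
  have 2: "\<exists>W\<in>\<W> n. compacts_within X K \<subseteq> W" if K: "K \<in> compact_sets X" for K n
  proof (rule k_coversD)
    show "compacts_within X K \<in> compact_sets (vietoris X)"
      using K compactin_vietoris_within[of X K] mem_compacts_within_self[OF K]
      by (auto simp: compact_sets_def)
  qed (use \<W> in blast)
  obtain F where F: "\<And>n. F n \<in> finite_parts (\<W> n)"
    and ev: "\<And>K. K \<in> compact_sets X \<Longrightarrow>
      \<forall>\<^sub>F n in sequentially. \<exists>W\<in>F n. compacts_within X K \<subseteq> W"
    by (rule k_hurewicz_select_traces[OF X, of \<W>]) (erule 1, erule 2, rule that, blast+)
  have "eventually_covers F \<K>" if \<K>: "\<K> \<in> compact_sets (vietoris X)" for \<K>
  proof -
    have "\<K> \<subseteq> compacts_within X (\<Union>\<K>)"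
      using \<K> compactin_subset_topspace[of "vietoris X" \<K>]
      by (auto simp: compacts_within_def compact_sets_def[of "vietoris X"] topspace_vietoris)
    then show ?thesis
      using ev[OF compact_Union_vietoris[OF \<K>]] unfolding eventually_covers_def
      by (elim eventually_mono) blast
  qed
  with F show "\<exists>F. (\<forall>n. F n \<in> finite_parts (\<W> n)) \<and>
      (\<forall>\<K>\<in>compact_sets (vietoris X). eventually_covers F \<K>)"
    by blast
qed

section \<open>The equivalence\<close>

lemma S_fin_groupable_iff_k_hurewicz:
  assumes "topspace Z \<noteq> {}"
  shows "S_fin (k_covers Z) (groupable_members (k_covers Z)) \<longleftrightarrow> k_hurewicz Z"
  using assms k_hurewicz_if_S_fin_groupable not_One_wins_if_k_hurewicz S_fin_if_not_One_wins
  by blast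

text \<open>
  Every outcome of a selection is countable, and every k-cover is infinite; so once countably
  infinite k-covers are groupable, groupability of the outcome is automatic.
\<close>

lemma k_hurewicz_iff_all_countable_k_covers_groupable:
  assumes ne: "topspace Z \<noteq> {}"
  shows "k_hurewicz Z \<longleftrightarrow> S_fin (k_covers Z) (k_covers Z) \<and>
    groupable_members (k_covers Z) = k_covers Z \<inter> countably_infinite_parts (proper_opens Z)"
    (is "_ \<longleftrightarrow> ?S \<and> ?G")
proof
  assume Z: "k_hurewicz Z"
  have "groupable_members (k_covers Z) \<subseteq> k_covers Z"
    by (auto simp: groupable_members_def)
  then have ?S
    using S_fin_groupable_iff_k_hurewicz[OF ne] Z unfolding S_fin_def by blast
  moreover have ?G
  proof (intro equalityI subsetI)
    fix \<C> assume gp: "\<C> \<in> groupable_members (k_covers Z)"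
    then have \<C>: "\<C> \<in> k_covers Z"
      by (simp add: groupable_members_def)
    obtain G where fin: "\<And>n::nat. finite (G n)" and un: "(\<Union>n. G n) = \<C>"
      using gp groupable_k_cover_iff[OF k_covers_subset_proper_opens[OF \<C>]] by blast
    have "countable (\<Union>n. G n)"
      using fin by (simp add: countable_finite)
    then have "countable \<C>"
      by (simp only: un)
    then show "\<C> \<in> k_covers Z \<inter> countably_infinite_parts (proper_opens Z)"
      using \<C> k_covers_subset_proper_opens[OF \<C>] k_cover_infinite[OF ne \<C>]
      by (simp add: countably_infinite_parts_def)
  next
    fix \<C> assume "\<C> \<in> k_covers Z \<inter> countably_infinite_parts (proper_opens Z)"
    then show "\<C> \<in> groupable_members (k_covers Z)"
      using groupable_if_countable_k_cover[OF Z] by (auto simp: countably_infinite_parts_def)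
  qed
  ultimately show "?S \<and> ?G" ..
next
  assume SG: "?S \<and> ?G"
  have "S_fin (k_covers Z) (groupable_members (k_covers Z))"
    unfolding S_fin_def
  proof (intro allI impI)
    fix \<U> :: "nat \<Rightarrow> 'a set set" assume "\<forall>n. \<U> n \<in> k_covers Z"
    then obtain F where F: "\<And>n. F n \<in> finite_parts (\<U> n)" and cov: "(\<Union>n. F n) \<in> k_covers Z"
      using SG unfolding S_fin_def by meson
    have "countable (\<Union>n. F n)"
      using F by (auto simp: finite_parts_def intro: countable_finite)
    then have "(\<Union>n. F n) \<in> groupable_members (k_covers Z)"
      using SG cov k_covers_subset_proper_opens[OF cov] k_cover_infinite[OF ne cov]
      by (simp add: countably_infinite_parts_def)
    with F show "\<exists>\<F>. (\<forall>n. \<F> n \<in> finite_parts (\<U> n)) \<and> (\<Union>n. \<F> n) \<in> groupable_members (k_covers Z)"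
      by blast
  qed
  then show "k_hurewicz Z"
    using S_fin_groupable_iff_k_hurewicz[OF ne] by blast
qed

theorem corollary33:
  fixes X :: "'a topology"
  assumes "Hausdorff_space X" and "\<not> compact_space X"
  shows
    "(hurewicz (vietoris X) \<longleftrightarrow>
        S_fin (k_covers (vietoris X)) (groupable_members (k_covers (vietoris X)))) \<and>
     (S_fin (k_covers (vietoris X)) (groupable_members (k_covers (vietoris X))) \<longleftrightarrow>
        S_fin (k_covers X) (k_covers X) \<and>
        groupable_members (k_covers X) =
          k_covers X \<inter> countably_infinite_parts (proper_opens X)) \<and>
     (S_fin (k_covers X) (k_covers X) \<and>
        groupable_members (k_covers X) =
          k_covers X \<inter> countably_infinite_parts (proper_opens X) \<longleftrightarrow>
        S_fin (k_covers X) (groupable_members (k_covers X))) \<and>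
     (S_fin (k_covers X) (groupable_members (k_covers X)) \<longleftrightarrow>
        \<not> One_wins_G_fin (k_covers X) (groupable_members (k_covers X)))"
proof -
  have X: "topspace X \<noteq> {}"
    using assms(2) by (auto simp: compact_space_def)
  then obtain x where "x \<in> topspace X"
    by blast
  then have "{x} \<in> topspace (vietoris X)"
    by (simp add: topspace_vietoris compact_sets_def)
  then have KX: "topspace (vietoris X) \<noteq> {}"
    by blast
  have "hurewicz (vietoris X) \<longleftrightarrow> k_hurewicz X"
    using hurewicz_hyperspace_imp_k_hurewicz k_hurewicz_imp_hurewicz_hyperspace assms by blast
  moreover have "k_hurewicz (vietoris X) \<longleftrightarrow> k_hurewicz X"
    using k_hurewicz_hyperspace_imp_k_hurewicz k_hurewicz_imp_k_hurewicz_hyperspace assms by blast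
  moreover have "\<not> One_wins_G_fin (k_covers X) (groupable_members (k_covers X)) \<longleftrightarrow> k_hurewicz X"
    using not_One_wins_if_k_hurewicz S_fin_if_not_One_wins S_fin_groupable_iff_k_hurewicz[OF X]
    by blast
  ultimately show ?thesis
    using S_fin_groupable_iff_k_hurewicz[OF X] S_fin_groupable_iff_k_hurewicz[OF KX]
      k_hurewicz_iff_all_countable_k_covers_groupable[OF X] by blast
qed

end
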